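(* Let $G$ be a connected graph with $e\ge 2$ edges and $\chi_{la}(G)=t\ge 2$, and let $f$, $V_1,\dots,V_t$, $c_1,\dots,c_t$, $r$, $b$ and $G(V_i,s)$ be as defined in the context. Suppose $G\not\cong K_{1,e}$, $r<t$ and $e+s\ge c_r$. Let $r+1\le i\le t$. (1) If $e<c_1$, then $\chi_{la}(G(V_i,s))=s+t-r$. (2) If $c_{j-1}\le e<c_j$ for some $j$ with $2\le j\le r$, then $s+t-r+b\le \chi_{la}(G(V_i,s))\le s+t-r+j-1$. Moreover, if $b=j-1$, then $\chi_{la}(G(V_i,s))=s+t-r+j-1$.
   Context: Graphs are finite and simple. Let $G=(V,E)$ be a connected graph of order at least 3. A local antimagic labeling of $G$ is a bijection $f:E\to\{1,\dots,|E|\}$ such that the induced vertex labeling $f^+(u)=\sum f(\varepsilon)$ (sum over all edges $\varepsilon$ incident to $u$) satisfies $f^+(x)\ne f^+(y)$ for every pair of adjacent vertices $x,y$. Let $c(f)$ be the number of distinct values of $f^+$. The local antimagic chromatic number is $\chi_{la}(G)=\min\{c(f): f \text{ is a local antimagic labeling of } G\}$. A pendant vertex is a vertex of degree 1; a pendant edge is an edge incident to a pendant vertex. Setting. $G$ is a connected graph with $e\ge 2$ edges ($e$ denotes the number of edges) and $\chi_{la}(G)=t\ge 2$. Let $f$ be a local antimagic labeling of $G$ with $c(f)=t$; its color classes form a partition of $V(G)$ into $t$ independent sets $V_1,\dots,V_t$ with $|V_i|=n_i\ge 1$, and $f^+(v)=c_i$ for each $v\in V_i$, where $c_1,\dots,c_t$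 are distinct. The integer $r$, $1\le r\le t$, is such that each non-pendant vertex of $G$ belongs to one of $V_1,\dots,V_r$ and, if $r<t$, each $V_i$ with $r+1\le i\le t$ is a singleton consisting of a pendant vertex. The classes are indexed so that $c_1<c_2<\cdots<c_r$ and $c_{r+1}<c_{r+2}<\cdots<c_t$. Let $b\ge 0$ be the number of pendant vertices of $G$ in $\bigcup_{i=1}^r V_i$, so $G$ has exactly $t-r+b$ pendant vertices. For $1\le i\le t$, write $V_i=\{v_a: 1\le a\le n_i\}$. $G(V_i,s)$ denotes the graph obtained from $G$ by adding $s$ pendant edges $v_aw_{a,k}$ ($1\le k\le s$), with new distinct vertices $w_{a,k}$, to each vertex $v_a\in V_i$. *)

theory Defs
  imports Main "HOL-Library.Disjoint_Sets"
begin

datatype 'a graph = Graph (verts: "'a set") (edges: "'a set set")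

definition finite_simple_graph :: "'a graph \<Rightarrow> bool" where
  "finite_simple_graph G \<longleftrightarrow>
     finite (verts G) \<and> (\<forall>\<epsilon>\<in>edges G. \<epsilon> \<subseteq> verts G \<and> card \<epsilon> = 2)"

definition adjacent :: "'a graph \<Rightarrow> 'a \<Rightarrow> 'a \<Rightarrow> bool" where
  "adjacent G u v \<longleftrightarrow> {u, v} \<in> edges G"

definition connected_graph :: "'a graph \<Rightarrow> bool" where
  "connected_graph G \<longleftrightarrow>
     verts G \<noteq> {} \<and> (\<forall>u\<in>verts G. \<forall>v\<in>verts G. (adjacent G)\<^sup>*\<^sup>* u v)"

definition incident_edges :: "'a graph \<Rightarrow> 'a \<Rightarrow> 'a set set" where
  "incident_edges G v = {\<epsilon> \<in> edges G. v \<in> \<epsilon>}"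

definition pendant :: "'a graph \<Rightarrow> 'a \<Rightarrow> bool" where
  "pendant G v \<longleftrightarrow> v \<in> verts G \<and> card (incident_edges G v) = 1"

definition independent_set :: "'a graph \<Rightarrow> 'a set \<Rightarrow> bool" where
  "independent_set G S \<longleftrightarrow> S \<subseteq> verts G \<and> (\<forall>u\<in>S. \<forall>v\<in>S. \<not> adjacent G u v)"

definition graph_isomorphic :: "'a graph \<Rightarrow> 'b graph \<Rightarrow> bool" where
  "graph_isomorphic G H \<longleftrightarrow>
     (\<exists>\<phi>. bij_betw \<phi> (verts G) (verts H) \<and>
          (\<forall>u\<in>verts G. \<forall>v\<in>verts G. adjacent G u v \<longleftrightarrow> adjacent H (\<phi> u) (\<phi> v)))"

definition complete_bipartite :: "nat \<Rightarrow> nat \<Rightarrow> (nat + nat) graph" where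
  "complete_bipartite m n =
     Graph (Inl ` {..<m} \<union> Inr ` {..<n})
           {{Inl i, Inr j} | i j. i < m \<and> j < n}"

definition induced_label :: "'a graph \<Rightarrow> ('a set \<Rightarrow> nat) \<Rightarrow> 'a \<Rightarrow> nat" where
  "induced_label G f u = (\<Sum>\<epsilon>\<in>incident_edges G u. f \<epsilon>)"

definition local_antimagic_labeling :: "'a graph \<Rightarrow> ('a set \<Rightarrow> nat) \<Rightarrow> bool" where
  "local_antimagic_labeling G f \<longleftrightarrow>
     bij_betw f (edges G) {1..card (edges G)} \<and>
     (\<forall>x\<in>verts G. \<forall>y\<in>verts G. adjacent G x y \<longrightarrow>
        induced_label G f x \<noteq> induced_label G f y)"

definition num_colors :: "'a graph \<Rightarrow> ('a set \<Rightarrow> nat) \<Rightarrow> nat" where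
  "num_colors G f = card (induced_label G f ` verts G)"

text \<open>The infimum of a nonempty set of naturals is its minimum; the value is unspecified
  for a graph without any local antimagic labeling, such as \<open>K\<^sub>2\<close>.\<close>

definition chi_la :: "'a graph \<Rightarrow> nat" where
  "chi_la G = Inf {num_colors G f | f. local_antimagic_labeling G f}"

text \<open>\<open>add_pendants G W s\<close> is \<open>G(W, s)\<close>. Old vertices are tagged with \<open>Inl\<close>, and
  \<open>Inr (v, k)\<close> is the \<open>k\<close>-th new neighbour of \<open>v\<close>, so that the new vertices are
  distinct from each other and from those of \<open>G\<close>.\<close>

definition add_pendants :: "'a graph \<Rightarrow> 'a set \<Rightarrow> nat \<Rightarrow> ('a + 'a \<times> nat) graph" where
  "add_pendants G W s =
     Graph (Inl ` verts G \<union> Inr ` (W \<times> {1..s}))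
           ((image Inl) ` edges G \<union> {{Inl v, Inr (v, k)} | v k. v \<in> W \<and> k \<in> {1..s}})"

end

theory Submission
  imports Defs
begin

text \<open>
  Write \<open>V i = {v}\<close>, let \<open>H\<close> be the graph obtained by hanging \<open>s\<close> new leaves on \<open>v\<close>, and note
  that \<open>s \<ge> 1\<close> in both cases, since \<open>e\<close> lies below some \<open>c k\<close> with \<open>k \<le> r\<close> while
  \<open>c k \<le> c r \<le> e + s\<close>.

  Upper bound (\<open>labeling_add_pendants\<close>): keep \<open>f\<close> on the old edges and give the new edges the
  labels \<open>e + 1, \<dots>, e + s\<close>. The colour of every old vertex other than \<open>v\<close> is unchanged, the new
  leaves receive exactly the colours \<open>e + 1, \<dots>, e + s\<close>, and the colour of \<open>v\<close> exceeds \<open>e + s\<close>,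
  hence exceeds all other colours. An old colour above \<open>e\<close> therefore coincides with the colour of
  a new leaf, and only the old colours that are at most \<open>e\<close> are counted separately: these are
  \<open>c 1, \<dots>, c (j - 1)\<close> (none in the first case) and the colours of the singleton classes
  other than \<open>V i\<close>.

  Lower bound (\<open>card_pendants_less_num_colors\<close>): under any labeling the pendant vertices have
  pairwise distinct colours, namely the labels of their edges, and the edge with the largest label
  has a non-pendant end, whose colour is larger than every label. So the number of colours exceeds
  the number of pendant vertices. In \<open>H\<close> there are \<open>s + (t - r) + b - 1\<close> of the latter, because
  \<open>v\<close> is no longer pendant.
\<close>

section \<open>Pendant vertices and the number of colours\<close>

lemma finite_edges: "finite_simple_graph G \<Longrightarrow> finite (edges G)"
  unfolding finite_simple_graph_def
  by (rule finite_subset[of _ "Pow (verts G)"]) auto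

lemma finite_incident_edges: "finite_simple_graph G \<Longrightarrow> finite (incident_edges G u)"
  by (simp add: incident_edges_def finite_edges)

lemma pendantE:
  assumes "pendant G u"
  obtains \<epsilon> where "incident_edges G u = {\<epsilon>}" "\<epsilon> \<in> edges G" "u \<in> \<epsilon>"
    "induced_label G f u = f \<epsilon>"
proof -
  from assms obtain \<epsilon> where \<epsilon>: "incident_edges G u = {\<epsilon>}"
    by (auto simp: pendant_def card_1_singleton_iff)
  hence "\<epsilon> \<in> incident_edges G u" by simp
  with \<epsilon> that[of \<epsilon>] show ?thesis
    by (auto simp: incident_edges_def induced_label_def)
qed

lemma label_bounds:
  assumes "local_antimagic_labeling G f" "\<epsilon> \<in> edges G"
  shows "1 \<le> f \<epsilon>" "f \<epsilon> \<le> card (edges G)"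
  using assms unfolding local_antimagic_labeling_def bij_betw_def by auto

text \<open>An edge with two pendant ends is a connected component of its own.\<close>

lemma connected_edge_has_nonpendant_end:
  assumes graph: "finite_simple_graph G" and conn: "connected_graph G"
    and two: "card (edges G) \<ge> 2" and \<epsilon>: "\<epsilon> \<in> edges G"
  shows "\<exists>x\<in>\<epsilon>. \<not> pendant G x"
proof (rule ccontr)
  assume "\<not> ?thesis"
  hence pend: "\<And>x. x \<in> \<epsilon> \<Longrightarrow> pendant G x" by blast
  have only: "\<epsilon>' = \<epsilon>" if x: "x \<in> \<epsilon>" "\<epsilon>' \<in> edges G" "x \<in> \<epsilon>'" for x \<epsilon>'
  proof -
    obtain \<delta> where "incident_edges G x = {\<delta>}" using pend[OF x(1)] by (rule pendantE)
    moreover have "\<epsilon> \<in> incident_edges G x" "\<epsilon>' \<in> incident_edges G x"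
      using x \<epsilon> by (auto simp: incident_edges_def)
    ultimately show ?thesis by auto
  qed
  from two have "\<not> edges G \<subseteq> {\<epsilon>}"
    using card_mono[of "{\<epsilon>}" "edges G"] by auto
  then obtain \<epsilon>' where \<epsilon>': "\<epsilon>' \<in> edges G" "\<epsilon>' \<noteq> \<epsilon>" by blast
  have ne: "card \<epsilon> = 2" "card \<epsilon>' = 2" "\<epsilon> \<subseteq> verts G" "\<epsilon>' \<subseteq> verts G"
    using graph \<epsilon> \<epsilon>' unfolding finite_simple_graph_def by auto
  then obtain x y where xy: "x \<in> \<epsilon>" "y \<in> \<epsilon>'" by fastforce
  have "(adjacent G)\<^sup>*\<^sup>* x y" using conn xy ne unfolding connected_graph_def by blast
  hence "y \<in> \<epsilon>"
  proof (induction rule: rtranclp_induct)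
    case base
    show ?case by (rule xy(1))
  next
    case (step y z)
    thus ?case using only[of y "{y, z}"] by (auto simp: adjacent_def)
  qed
  with only[of y \<epsilon>'] xy \<epsilon>' show False by blast
qed

text \<open>The colours of the pendant vertices are distinct labels, and one more colour is larger than
  every label: that of a non-pendant end of the edge with the largest label.\<close>

lemma card_pendants_less_num_colors:
  assumes graph: "finite_simple_graph G" and ne: "edges G \<noteq> {}"
    and nonpendant: "\<And>\<epsilon>. \<epsilon> \<in> edges G \<Longrightarrow> \<exists>x\<in>\<epsilon>. \<not> pendant G x"
    and f: "local_antimagic_labeling G f"
  shows "card {u. pendant G u} < num_colors G f"
proof -
  let ?m = "card (edges G)" and ?P = "{u. pendant G u}"
  have fin: "finite (edges G)" "finite (verts G)"
    using graph finite_edges by (auto simp: finite_simple_graph_def)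
  have bij: "bij_betw f (edges G) {1..?m}"
    using f by (simp add: local_antimagic_labeling_def)
  have "?m \<in> {1..?m}" using ne fin by (simp add: card_gt_0_iff Suc_le_eq)
  then obtain \<epsilon> where \<epsilon>: "\<epsilon> \<in> edges G" "f \<epsilon> = ?m"
    using bij unfolding bij_betw_def by (metis imageE)
  obtain x where x: "x \<in> \<epsilon>" "\<not> pendant G x" using nonpendant \<epsilon> by blast
  have xG: "x \<in> verts G" using graph x \<epsilon> by (auto simp: finite_simple_graph_def)
  have \<epsilon>x: "\<epsilon> \<in> incident_edges G x" using x \<epsilon> by (simp add: incident_edges_def)
  have "incident_edges G x \<noteq> {\<epsilon>}" using x xG by (auto simp: pendant_def)
  then obtain \<epsilon>' where \<epsilon>': "\<epsilon>' \<in> incident_edges G x" "\<epsilon>' \<noteq> \<epsilon>" using \<epsilon>x by blast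
  have "f \<epsilon> + f \<epsilon>' = sum f {\<epsilon>, \<epsilon>'}" using \<epsilon>' by simp
  also have "\<dots> \<le> induced_label G f x" unfolding induced_label_def
    by (rule sum_mono2) (use \<epsilon>x \<epsilon>' finite_incident_edges[OF graph] in auto)
  finally have big: "?m < induced_label G f x"
    using label_bounds(1)[OF f, of \<epsilon>'] \<epsilon> \<epsilon>' by (auto simp: incident_edges_def)
  have inj: "inj_on (induced_label G f) ?P"
  proof (rule inj_onI)
    fix u w assume uw: "u \<in> ?P" "w \<in> ?P" "induced_label G f u = induced_label G f w"
    obtain \<alpha> where \<alpha>: "\<alpha> \<in> edges G" "u \<in> \<alpha>" "induced_label G f u = f \<alpha>"
      using uw(1) by (auto elim: pendantE)
    obtain \<beta> where \<beta>: "\<beta> \<in> edges G" "w \<in> \<beta>" "induced_label G f w = f \<beta>"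
      using uw(2) by (auto elim: pendantE)
    have "\<alpha> = \<beta>" using uw(3) \<alpha> \<beta> bij by (auto simp: bij_betw_def dest: inj_onD)
    obtain z where z: "z \<in> \<alpha>" "\<not> pendant G z" using nonpendant \<alpha> by blast
    have "card \<alpha> = 2" using graph \<alpha> by (auto simp: finite_simple_graph_def)
    then obtain p q where "\<alpha> = {p, q}" by (auto simp: card_2_iff)
    with z uw \<open>\<alpha> = \<beta>\<close> \<alpha> \<beta> show "u = w" by auto
  qed
  have small: "induced_label G f u \<le> ?m" if "u \<in> ?P" for u
    using that label_bounds(2)[OF f] by (metis mem_Collect_eq pendantE)
  have "card ?P = card (induced_label G f ` ?P)" using inj by (simp add: card_image)
  also have "\<dots> < card (induced_label G f ` verts G)"
  proof (rule psubset_card_mono)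
    show "finite (induced_label G f ` verts G)" using fin by simp
    have "induced_label G f x \<notin> induced_label G f ` ?P" using small big by fastforce
    moreover have "induced_label G f ` ?P \<subseteq> induced_label G f ` verts G"
      by (auto simp: pendant_def)
    ultimately show "induced_label G f ` ?P \<subset> induced_label G f ` verts G" using xG by blast
  qed
  finally show ?thesis by (simp add: num_colors_def)
qed

section \<open>Hanging leaves on a pendant vertex\<close>

lemma edges_add_pendants:
  "edges (add_pendants G {v} s) =
     (`) Inl ` edges G \<union> (\<lambda>k. {Inl v, Inr (v, k)}) ` {1..s}"
  by (auto simp: add_pendants_def)

lemma verts_add_pendants:
  "verts (add_pendants G {v} s) = Inl ` verts G \<union> (\<lambda>k. Inr (v, k)) ` {1..s}"
  by (auto simp: add_pendants_def)

lemma inj_image_Inl: "inj_on ((`) Inl) A"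
  by (rule inj_onI) (simp add: inj_image_eq_iff)

lemma image_Inl_neq: "Inl ` A \<noteq> {Inl v, Inr w}"
  by auto

lemma incident_old_vertex:
  "u \<noteq> v \<Longrightarrow> incident_edges (add_pendants G {v} s) (Inl u) = (`) Inl ` incident_edges G u"
  unfolding incident_edges_def edges_add_pendants by auto

lemma incident_base_vertex:
  "incident_edges (add_pendants G {v} s) (Inl v) =
     (`) Inl ` incident_edges G v \<union> (\<lambda>k. {Inl v, Inr (v, k)}) ` {1..s}"
  unfolding incident_edges_def edges_add_pendants by auto

lemma incident_new_leaf:
  "k \<in> {1..s} \<Longrightarrow> incident_edges (add_pendants G {v} s) (Inr (v, k)) = {{Inl v, Inr (v, k)}}"
  unfolding incident_edges_def edges_add_pendants by auto

lemma inj_new_edge: "inj_on (\<lambda>k. {Inl v, Inr (v, k)}) A"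
  by (rule inj_onI) (auto simp: doubleton_eq_iff)

lemma finite_simple_add_pendants:
  assumes "finite_simple_graph G" "v \<in> verts G"
  shows "finite_simple_graph (add_pendants G {v} s)"
  using assms unfolding finite_simple_graph_def edges_add_pendants verts_add_pendants
  by (auto simp: card_image)

lemma card_edges_add_pendants:
  assumes "finite_simple_graph G"
  shows "card (edges (add_pendants G {v} s)) = card (edges G) + s"
proof -
  have "card (edges (add_pendants G {v} s)) =
      card ((`) Inl ` edges G :: ('a + 'a \<times> nat) set set)
        + card ((\<lambda>k. {Inl v, Inr (v, k)}) ` {1..s} :: ('a + 'a \<times> nat) set set)"
    unfolding edges_add_pendants
    by (rule card_Un_disjoint) (auto simp: finite_edges[OF assms])
  thus ?thesis by (simp only: card_image[OF inj_image_Inl] card_image[OF inj_new_edge]) simp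
qed

lemma pendant_old_vertex:
  "u \<noteq> v \<Longrightarrow> pendant (add_pendants G {v} s) (Inl u) \<longleftrightarrow> pendant G u"
  by (auto simp: pendant_def incident_old_vertex verts_add_pendants card_image[OF inj_image_Inl])

lemma pendant_new_leaf:
  "k \<in> {1..s} \<Longrightarrow> pendant (add_pendants G {v} s) (Inr (v, k))"
  by (simp add: pendant_def incident_new_leaf verts_add_pendants)

lemma base_vertex_not_pendant:
  assumes v: "pendant G v" and s: "1 \<le> s"
  shows "\<not> pendant (add_pendants G {v} s) (Inl v)"
proof
  assume "pendant (add_pendants G {v} s) (Inl v)"
  then obtain \<delta> where \<delta>: "incident_edges (add_pendants G {v} s) (Inl v) = {\<delta>}"
    by (rule pendantE)
  obtain \<epsilon> where "incident_edges G v = {\<epsilon>}" using v by (rule pendantE)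
  hence "Inl ` \<epsilon> \<in> {\<delta>}" "{Inl v, Inr (v, 1)} \<in> {\<delta>}"
    unfolding \<delta>[symmetric] incident_base_vertex using s by auto
  thus False using image_Inl_neq by fastforce
qed

lemma card_pendants_add_pendants:
  assumes graph: "finite_simple_graph G" and v: "pendant G v"
  shows "card {u. pendant G u} + s \<le> card {x. pendant (add_pendants G {v} s) x} + 1"
proof -
  let ?P = "{u. pendant G u}" and ?H = "add_pendants G {v} s"
  have fin: "finite ?P"
    using graph by (auto simp: finite_simple_graph_def pendant_def elim: finite_subset[rotated])
  have "finite (verts ?H)"
    using finite_simple_add_pendants[OF graph] v
    by (auto simp: finite_simple_graph_def pendant_def)
  hence finH: "finite {x. pendant ?H x}"
    by (rule finite_subset[rotated]) (auto simp: pendant_def)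
  have "card (Inl ` (?P - {v}) \<union> (\<lambda>k. Inr (v, k)) ` {1..s}) =
      card (Inl ` (?P - {v}) :: ('a + 'a \<times> nat) set)
        + card ((\<lambda>k. Inr (v, k)) ` {1..s} :: ('a + 'a \<times> nat) set)"
    by (rule card_Un_disjoint) (use fin in auto)
  also have "\<dots> = (card ?P - 1) + s"
    using fin v by (simp add: card_image inj_on_def)
  finally have "(card ?P - 1) + s = card (Inl ` (?P - {v}) \<union> (\<lambda>k. Inr (v, k)) ` {1..s})"
    by simp
  also have "\<dots> \<le> card {x. pendant ?H x}"
    by (rule card_mono[OF finH]) (auto simp: pendant_old_vertex intro!: pendant_new_leaf)
  finally have "(card ?P - 1) + s \<le> card {x. pendant ?H x}" .
  thus ?thesis by simp
qed

section \<open>Extending a labeling to the new leaves\<close>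

text \<open>An edge without a new end is \<open>Inl ` \<epsilon>\<close> for an old edge \<open>\<epsilon>\<close>; any other edge has exactly one
  new end \<open>Inr (v, k)\<close>, and the description operator recovers its index \<open>k\<close>.\<close>

definition extend_label :: "('a set \<Rightarrow> nat) \<Rightarrow> nat \<Rightarrow> ('a + 'a \<times> nat) set \<Rightarrow> nat" where
  "extend_label f e \<epsilon> =
     (if \<epsilon> \<subseteq> range Inl then f (Inl -` \<epsilon>) else e + (THE k. \<exists>w. Inr (w, k) \<in> \<epsilon>))"

lemma extend_label_old:
  fixes \<epsilon> :: "'a set"
  shows "extend_label f e (Inl ` \<epsilon>) = f \<epsilon>"
proof -
  have "Inl -` (Inl ` \<epsilon> :: ('a + 'a \<times> nat) set) = \<epsilon>" by auto
  thus ?thesis by (simp add: extend_label_def image_mono)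
qed

lemma extend_label_new: "extend_label f e {Inl v, Inr (v, k)} = e + k"
  by (auto simp: extend_label_def)

lemma induced_extend_old_vertex:
  "u \<noteq> v \<Longrightarrow> induced_label (add_pendants G {v} s) (extend_label f e) (Inl u) = induced_label G f u"
  by (simp add: induced_label_def incident_old_vertex sum.reindex[OF inj_image_Inl]
      extend_label_old o_def)

lemma induced_extend_new_leaf:
  "k \<in> {1..s} \<Longrightarrow> induced_label (add_pendants G {v} s) (extend_label f e) (Inr (v, k)) = e + k"
  by (simp add: induced_label_def incident_new_leaf extend_label_new)

text \<open>The old edge at \<open>v\<close> and the new edge with the largest label already exceed \<open>e + s\<close>.\<close>

lemma induced_extend_base_vertex:
  assumes v: "pendant G v" and f: "local_antimagic_labeling G f" and s: "1 \<le> s"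
  shows "e + s < induced_label (add_pendants G {v} s) (extend_label f e) (Inl v)"
proof -
  let ?H = "add_pendants G {v} s"
  obtain \<epsilon> where \<epsilon>: "incident_edges G v = {\<epsilon>}" "\<epsilon> \<in> edges G" using v by (rule pendantE)
  let ?\<alpha> = "Inl ` \<epsilon> :: ('a + 'a \<times> nat) set" and ?\<beta> = "{Inl v, Inr (v, s)}"
  have "e + s < f \<epsilon> + (e + s)" using label_bounds(1)[OF f \<epsilon>(2)] by simp
  also have "\<dots> = sum (extend_label f e) {?\<alpha>, ?\<beta>}"
    using image_Inl_neq[of \<epsilon> v "(v, s)"] by (simp add: extend_label_old extend_label_new)
  also have "\<dots> \<le> induced_label ?H (extend_label f e) (Inl v)"
    unfolding induced_label_def
    by (rule sum_mono2) (use \<epsilon> s in \<open>auto simp: incident_base_vertex\<close>)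
  finally show ?thesis .
qed

lemma bij_extend_label:
  assumes f: "bij_betw f (edges G) {1..e}"
  shows "bij_betw (extend_label f e) (edges (add_pendants G {v} s)) {1..e + s}"
proof -
  have old: "bij_betw (extend_label f e) ((`) Inl ` edges G) {1..e}"
    using f by (auto simp: bij_betw_def inj_on_def image_image extend_label_old)
  have "(\<lambda>k. e + k) ` {1..s} = {e + 1..e + s}"
    by (simp add: add.commute)
  hence new: "bij_betw (extend_label f e) ((\<lambda>k. {Inl v, Inr (v, k)}) ` {1..s}) {e + 1..e + s}"
    by (auto simp: bij_betw_def inj_on_def image_image extend_label_new)
  have "{1..e} \<union> {e + 1..e + s} = {1..e + s}" by auto
  thus ?thesis
    using bij_betw_combine[OF old new] unfolding edges_add_pendants by auto
qed

text \<open>The new leaves receive all the colours from \<open>e + 1\<close> to \<open>e + s\<close>, so every old colour in that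
  range is absorbed and only the old colours up to \<open>e\<close> are counted; the additional colour is
  that of \<open>v\<close>.\<close>

lemma labeling_add_pendants:
  assumes graph: "finite_simple_graph G" and v: "pendant G v" and s: "1 \<le> s"
    and f: "local_antimagic_labeling G f" and e: "e = card (edges G)"
    and large: "\<And>u. u \<in> verts G \<Longrightarrow> induced_label G f u \<le> e + s"
  shows "local_antimagic_labeling (add_pendants G {v} s) (extend_label f e)"
    and "num_colors (add_pendants G {v} s) (extend_label f e)
      \<le> s + 1 + card (induced_label G f ` (verts G - {v}) \<inter> {..e})"
proof -
  let ?H = "add_pendants G {v} s" and ?g = "extend_label f e"
  let ?L = "induced_label ?H ?g"
  have top: "e + s < ?L (Inl v)" by (rule induced_extend_base_vertex[OF v f s])
  have below: "?L x \<le> e + s" if "x \<in> verts ?H" "x \<noteq> Inl v" for x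
  proof (cases x)
    case (Inl u)
    with that have "u \<noteq> v" "u \<in> verts G" by (auto simp: verts_add_pendants)
    with large Inl show ?thesis by (simp add: induced_extend_old_vertex)
  next
    case (Inr w)
    with that show ?thesis by (auto simp: verts_add_pendants induced_extend_new_leaf)
  qed
  have "?L x \<noteq> ?L y" if xy: "x \<in> verts ?H" "y \<in> verts ?H" "adjacent ?H x y" for x y
  proof (cases "x = Inl v \<or> y = Inl v")
    case True
    have "{x, y} \<in> edges ?H" using xy by (simp add: adjacent_def)
    hence "card {x, y} = 2"
      using finite_simple_add_pendants[OF graph, of v s] v
      by (simp add: finite_simple_graph_def pendant_def)
    hence "x \<noteq> y" by auto
    with True below[OF xy(1)] below[OF xy(2)] top show ?thesis by auto
  next
    case False
    then obtain \<epsilon> where \<epsilon>: "\<epsilon> \<in> edges G" "{x, y} = Inl ` \<epsilon>"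
      using xy(3) unfolding adjacent_def edges_add_pendants by (auto simp: doubleton_eq_iff)
    then obtain p q where pq: "x = Inl p" "y = Inl q" by (metis imageE insertCI)
    have "\<epsilon> = {p, q}" using \<epsilon>(2) unfolding pq by (auto simp: set_eq_iff image_iff)
    hence "adjacent G p q" "p \<in> verts G" "q \<in> verts G"
      using \<epsilon> graph by (auto simp: adjacent_def finite_simple_graph_def)
    thus ?thesis using f False pq
      by (auto simp: local_antimagic_labeling_def induced_extend_old_vertex)
  qed
  moreover have "bij_betw ?g (edges ?H) {1..card (edges ?H)}"
    using bij_extend_label[of f G e v s] f
    by (simp add: card_edges_add_pendants[OF graph] e local_antimagic_labeling_def)
  ultimately show "local_antimagic_labeling ?H ?g"
    unfolding local_antimagic_labeling_def by blast
  let ?C = "induced_label G f ` (verts G - {v}) \<inter> {..e}"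
  have "?L ` verts ?H \<subseteq> {e + 1..e + s} \<union> {?L (Inl v)} \<union> ?C"
  proof
    fix a assume "a \<in> ?L ` verts ?H"
    then obtain x where x: "x \<in> verts ?H" "a = ?L x" by blast
    consider "x = Inl v" | u where "x = Inl u" "u \<in> verts G" "u \<noteq> v"
      | k where "x = Inr (v, k)" "k \<in> {1..s}"
      using x(1) unfolding verts_add_pendants by auto
    thus "a \<in> {e + 1..e + s} \<union> {?L (Inl v)} \<union> ?C"
    proof cases
      case 2
      hence "a = induced_label G f u" using x by (simp add: induced_extend_old_vertex)
      thus ?thesis using 2 large[of u] by (cases "a \<le> e") auto
    qed (use x in \<open>auto simp: induced_extend_new_leaf\<close>)
  qed
  hence "num_colors ?H ?g \<le> card ({e + 1..e + s} \<union> {?L (Inl v)} \<union> ?C)"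
    unfolding num_colors_def by (rule card_mono[rotated]) simp
  also have "\<dots> \<le> card {e + 1..e + s} + card {?L (Inl v)} + card ?C"
    by (intro order_trans[OF card_Un_le] add_mono card_Un_le order_refl)
  finally show "num_colors ?H ?g \<le> s + 1 + card ?C" by simp
qed

section \<open>Bounds on the local antimagic chromatic number\<close>

lemma chi_la_le: "local_antimagic_labeling G f \<Longrightarrow> chi_la G \<le> num_colors G f"
  unfolding chi_la_def by (rule cInf_lower) auto

text \<open>Without any labeling the infimum would be unspecified, hence the first assumption.\<close>

lemma chi_la_ge:
  assumes "local_antimagic_labeling G f"
    and "\<And>g. local_antimagic_labeling G g \<Longrightarrow> n \<le> num_colors G g"
  shows "n \<le> chi_la G"
  unfolding chi_la_def by (rule cInf_greatest) (use assms in auto)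

lemma chi_la_add_pendants_bounds:
  assumes graph: "finite_simple_graph G" and conn: "connected_graph G"
    and e: "e = card (edges G)" "e \<ge> 2"
    and v: "pendant G v" and s: "1 \<le> s" and f: "local_antimagic_labeling G f"
    and large: "\<And>u. u \<in> verts G \<Longrightarrow> induced_label G f u \<le> e + s"
  shows "card {u. pendant G u} + s \<le> chi_la (add_pendants G {v} s)"
    and "chi_la (add_pendants G {v} s)
      \<le> s + 1 + card (induced_label G f ` (verts G - {v}) \<inter> {..e})"
proof -
  let ?H = "add_pendants G {v} s"
  note ext = labeling_add_pendants[OF graph v s f e(1) large]
  show "chi_la ?H \<le> s + 1 + card (induced_label G f ` (verts G - {v}) \<inter> {..e})"
    using chi_la_le[OF ext(1)] ext(2) by linarith
  have nonpendant: "\<exists>x\<in>\<epsilon>. \<not> pendant ?H x" if "\<epsilon> \<in> edges ?H" for \<epsilon>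
  proof -
    have base: "\<not> pendant ?H (Inl v)" by (rule base_vertex_not_pendant[OF v s])
    from that consider \<delta> where "\<delta> \<in> edges G" "\<epsilon> = Inl ` \<delta>" | k where "\<epsilon> = {Inl v, Inr (v, k)}"
      unfolding edges_add_pendants by auto
    thus ?thesis
    proof cases
      case 1
      then obtain x where "x \<in> \<delta>" "\<not> pendant G x"
        using connected_edge_has_nonpendant_end[OF graph conn] e by blast
      thus ?thesis using 1 v pendant_old_vertex[of x v G s] by auto
    qed (use base in auto)
  qed
  show "card {u. pendant G u} + s \<le> chi_la ?H"
  proof (rule chi_la_ge[OF ext(1)])
    fix g assume "local_antimagic_labeling ?H g"
    moreover have "edges ?H \<noteq> {}" using s by (auto simp: edges_add_pendants)
    ultimately have "card {x. pendant ?H x} < num_colors ?H g"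
      using nonpendant finite_simple_add_pendants[OF graph] v
      by (intro card_pendants_less_num_colors) (auto simp: pendant_def)
    thus "card {u. pendant G u} + s \<le> num_colors ?H g"
      using card_pendants_add_pendants[OF graph v, of s] by linarith
  qed
qed

theorem theorem2p2:
  fixes G :: "'a graph" and f :: "'a set \<Rightarrow> nat"
    and V :: "nat \<Rightarrow> 'a set" and c :: "nat \<Rightarrow> nat"
    and e t r b s i :: nat
  assumes graph: "finite_simple_graph G" and conn: "connected_graph G"
    and e: "e = card (edges G)" "e \<ge> 2"
    and t: "chi_la G = t" "t \<ge> 2"
    and f: "local_antimagic_labeling G f" "num_colors G f = t"
    and partition: "(\<Union>k\<in>{1..t}. V k) = verts G" "disjoint_family_on V {1..t}"
      "\<And>k. k \<in> {1..t} \<Longrightarrow> card (V k) \<ge> 1"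
    and indep: "\<And>k. k \<in> {1..t} \<Longrightarrow> independent_set G (V k)"
    and colors: "\<And>k v. k \<in> {1..t} \<Longrightarrow> v \<in> V k \<Longrightarrow> induced_label G f v = c k"
      "inj_on c {1..t}"
    and r: "1 \<le> r" "r \<le> t"
    and nonpendant: "\<And>v. v \<in> verts G \<Longrightarrow> \<not> pendant G v \<Longrightarrow> v \<in> (\<Union>k\<in>{1..r}. V k)"
    and singletons: "\<And>k. k \<in> {r+1..t} \<Longrightarrow> \<exists>v. V k = {v} \<and> pendant G v"
    and order: "strict_mono_on {1..r} c" "strict_mono_on {r+1..t} c"
    and b: "b = card {v \<in> (\<Union>k\<in>{1..r}. V k). pendant G v}"
    and not_star: "\<not> graph_isomorphic G (complete_bipartite 1 e)"
    and r_less: "r < t"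
    and large: "e + s \<ge> c r"
    and i: "i \<in> {r+1..t}"
  shows "(e < c 1 \<longrightarrow> chi_la (add_pendants G (V i) s) = s + (t - r)) \<and>
    (\<forall>j\<in>{2..r}. c (j - 1) \<le> e \<and> e < c j \<longrightarrow>
        s + (t - r) + b \<le> chi_la (add_pendants G (V i) s) \<and>
        chi_la (add_pendants G (V i) s) \<le> s + (t - r) + (j - 1) \<and>
        (b = j - 1 \<longrightarrow> chi_la (add_pendants G (V i) s) = s + (t - r) + (j - 1)))"
proof -
  obtain v where v: "V i = {v}" "pendant G v" using singletons[OF i] by blast
  let ?H = "add_pendants G (V i) s"
  have mono: "c k \<le> c r" if "k \<in> {1..r}" for k
    using strict_mono_onD[OF order(1), of k r] that r by (cases "k = r") auto
  have low: "c k \<le> e" if k: "k \<in> {r+1..t}" for k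
  proof -
    obtain u where u: "V k = {u}" "pendant G u" using singletons[OF k] by blast
    have "induced_label G f u \<le> e"
      using u(2) label_bounds(2)[OF f(1)] e(1) by (metis pendantE)
    thus ?thesis using colors(1)[of k u] u k by simp
  qed
  have classes: "{1..t} = {1..r} \<union> {r+1..t}" using r by auto
  have large': "induced_label G f u \<le> e + s" if u: "u \<in> verts G" for u
  proof -
    obtain k where k: "k \<in> {1..t}" "u \<in> V k" using u partition(1) by blast
    hence "k \<in> {1..r} \<or> k \<in> {r+1..t}" by auto
    thus ?thesis using colors(1)[OF k] mono[of k] low[of k] large by auto
  qed
  have pend: "card {u. pendant G u} = b + (t - r)"
  proof -
    have "{u. pendant G u} = {v \<in> (\<Union>k\<in>{1..r}. V k). pendant G v} \<union> (\<Union>k\<in>{r+1..t}. V k)"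
      (is "_ = ?A \<union> ?B")
    proof
      show "{u. pendant G u} \<subseteq> ?A \<union> ?B"
        using partition(1) classes by (auto simp: pendant_def)
      show "?A \<union> ?B \<subseteq> {u. pendant G u}" using singletons by fastforce
    qed
    moreover have fin: "finite {u. pendant G u}"
      using graph by (auto simp: finite_simple_graph_def pendant_def elim: finite_subset[rotated])
    moreover have "?A \<inter> ?B = {}"
    proof -
      have "V k \<inter> V l = {}" if "k \<in> {1..r}" "l \<in> {r+1..t}" for k l
        using disjoint_family_onD[OF partition(2), of k l] that r by auto
      thus ?thesis by blast
    qed
    ultimately have "card {u. pendant G u} = card ?A + card ?B"
      by (metis card_Un_disjoint finite_Un)
    moreover have "card ?B = (\<Sum>k\<in>{r+1..t}. card (V k))"
    proof (rule card_UN_disjoint)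
      show "\<forall>k\<in>{r+1..t}. finite (V k)" using singletons by fastforce
      show "\<forall>k\<in>{r+1..t}. \<forall>l\<in>{r+1..t}. k \<noteq> l \<longrightarrow> V k \<inter> V l = {}"
        using partition(2) by (auto simp: disjoint_family_on_def)
    qed simp
    moreover have "(\<Sum>k\<in>{r+1..t}. card (V k)) = (\<Sum>k\<in>{r+1..t}. 1)"
      by (rule sum.cong) (use singletons in fastforce)+
    ultimately show ?thesis by (simp add: b)
  qed
  have lower: "s + (t - r) + b \<le> chi_la ?H" if "1 \<le> s"
    using chi_la_add_pendants_bounds(1)[OF graph conn e v(2) that f(1) large'] pend v by simp
  \<comment> \<open>The case \<open>j = 1\<close> gives the upper half of the first claim.\<close>
  have upper: "chi_la ?H \<le> s + (t - r) + (j - 1)" if j: "1 \<le> j" "j \<le> r" "e < c j" and s: "1 \<le> s"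
    for j
  proof -
    let ?I = "{1..j-1} \<union> ({r+1..t} - {i})"
    have "induced_label G f ` (verts G - {v}) \<inter> {..e} \<subseteq> c ` ?I"
    proof
      fix a assume "a \<in> induced_label G f ` (verts G - {v}) \<inter> {..e}"
      then obtain u where u: "u \<in> verts G" "u \<noteq> v" "a = induced_label G f u" "a \<le> e" by auto
      then obtain k where k: "k \<in> {1..t}" "u \<in> V k" using partition(1) by blast
      have a: "a = c k" using colors(1)[OF k] u by simp
      have "k \<noteq> i" using k u v by auto
      have "\<not> (j \<le> k \<and> k \<le> r)"
      proof
        assume "j \<le> k \<and> k \<le> r"
        hence "c j \<le> c k" using strict_mono_onD[OF order(1), of j k] j by (cases "j = k") auto
        thus False using a u j by simp
      qed
      hence "k \<in> ?I" using \<open>k \<noteq> i\<close> k by auto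
      thus "a \<in> c ` ?I" using a by blast
    qed
    hence "card (induced_label G f ` (verts G - {v}) \<inter> {..e}) \<le> card (c ` ?I)"
      by (rule card_mono[rotated]) simp
    also have "\<dots> \<le> card ?I" by (rule card_image_le) simp
    also have "\<dots> \<le> card {1..j-1} + card ({r+1..t} - {i})" by (rule card_Un_le)
    also have "\<dots> = (j - 1) + (t - r - 1)" using i by simp
    finally show ?thesis
      using chi_la_add_pendants_bounds(2)[OF graph conn e v(2) s f(1) large'] v r_less by simp
  qed
  have s: "1 \<le> s" if "j \<in> {1..r}" "e < c j" for j
    using mono[OF that(1)] that large by simp
  show ?thesis
  proof (intro conjI impI ballI)
    assume "e < c 1"
    thus "chi_la ?H = s + (t - r)" using s[of 1] upper[of 1] lower r by force
  next
    fix j assume j: "j \<in> {2..r}" "c (j - 1) \<le> e \<and> e < c j"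
    hence s: "1 \<le> s" using s[of j] by simp
    show lo: "s + (t - r) + b \<le> chi_la ?H" by (rule lower[OF s])
    show up: "chi_la ?H \<le> s + (t - r) + (j - 1)" using upper[of j] j s by simp
    show "chi_la ?H = s + (t - r) + (j - 1)" if "b = j - 1" using lo up that by simp
  qed
qed

end
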